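(* Let $\chi\in\Pi_\infty$ have more than one point of support. Consider the recursive tree system $(\chi,h)$ with automaton distribution map $\Psi$. Let $x_1$ be the largest fixed point of $\Psi$. Then $x_1$ is interpretable, i.e. there is an interpretation of $(\chi,h)$ of $\mathrm{GW}_\chi$-measure $x_1$, and its associated interpretation is the event that $T\sim\mathrm{GW}_\chi$ contains an admissible subtree.
   Context: A child distribution $\chi$ is a probability measure on $\mathbb{N}=\{0,1,2,\ldots\}$; write $\chi(n)=\chi(\{n\})$. $\Pi_\infty$ is the set of probability measures on $\mathbb{N}$ with all moments finite. A recursive tree system $(\chi,h)$ consists of a child distribution $\chi$ and a threshold function $h\colon\mathbb{N}\to\{1,2,3,\ldots\}$ (so $h(\ell)\geq 1$ for all $\ell\geq 0$). Its automaton distribution map is $\Psi\colon[0,1]\to[0,1]$, $\Psi(x)=\sum_{\ell=0}^\infty \chi(\ell)\,\mathbb{P}[\mathrm{Bin}(\ell,x)\geq h(\ell)]$, where $\mathrm{Bin}(\ell,x)$ is a binomial random variable. $\mathrm{GW}_\chi$ is the Galton--Watson measure with child distribution $\chi$ on the space of rooted trees. For a rooted tree $t$, $\ell(t)$ is the number of children of the root, and the root-child subtrees of $t$ are the subtrees originated by the children of the root. For a set of trees $\mathcal{T}$, $c(t,\mathcal{T})$ is the number of root-child subtrees of $t$ that are elements of $\mathcal{T}$. A $\mathrm{GW}_\chi$-measurable set of trees $\mathcal{T}$ is an interpretation of $(\chi,h)$ if, for $\mathrm{GW}_\chi$-a.e. rooted tree $t$, $t\in\mathcal{T}\iff c(t,\mathcal{T})\geq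 h(\ell(t))$. It is said to be associated with the fixed point $x_1$ if $\mathrm{GW}_\chi(\mathcal{T})=x_1$ (interpretations are considered up to $\mathrm{GW}_\chi$-negligible sets). $n_t(v)$ denotes the number of children of a vertex $v$ in a rooted tree $t$. A subtree $s$ of a rooted tree $t$ is admissible (with respect to $h$) if $s$ contains the root of $t$ and $n_s(v)\geq h(n_t(v))$ for all vertices $v\in s$. *)

theory Defs
  imports "HOL-Probability.Probability"
begin

section \<open>Child distributions and recursive tree systems\<close>

definition Pi_infinity :: "nat pmf set" where
  "Pi_infinity = {chi. \<forall>k::nat. integrable (measure_pmf chi) (\<lambda>n. real n ^ k)}"

definition recursive_tree_system :: "nat pmf \<Rightarrow> (nat \<Rightarrow> nat) \<Rightarrow> bool" where
  "recursive_tree_system chi h \<longleftrightarrow> (\<forall>l. 1 \<le> h l)"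

text \<open>Only arguments in \<open>{0..1}\<close> are meaningful here, as for \<^const>\<open>binomial_pmf\<close>.\<close>

definition automaton_map :: "nat pmf \<Rightarrow> (nat \<Rightarrow> nat) \<Rightarrow> real \<Rightarrow> real" where
  "automaton_map chi h x =
     (\<Sum>l. pmf chi l * measure_pmf.prob (binomial_pmf l x) {k. h l \<le> k})"

definition largest_fixed_point :: "nat pmf \<Rightarrow> (nat \<Rightarrow> nat) \<Rightarrow> real \<Rightarrow> bool" where
  "largest_fixed_point chi h x \<longleftrightarrow>
     x \<in> {0..1} \<and> automaton_map chi h x = x \<and>
     (\<forall>y\<in>{0..1}. automaton_map chi h y = y \<longrightarrow> y \<le> x)"

section \<open>Rooted trees and the Galton--Watson measure\<close>

text \<open>
  Rooted, locally finite trees are encoded as sets of vertices in Ulam--Harris notation: the root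
  is \<open>[]\<close>, and the children of a vertex \<open>v\<close> with \<open>n\<close> children are \<open>v @ [0], \<dots>, v @ [n - 1]\<close>.
\<close>

type_synonym vertex = "nat list"

definition n_children :: "vertex set \<Rightarrow> vertex \<Rightarrow> nat" where
  "n_children t v = card {i. v @ [i] \<in> t}"

definition rooted_trees :: "vertex set set" where
  "rooted_trees =
     {t. [] \<in> t \<and> (\<forall>v i. v @ [i] \<in> t \<longrightarrow> v \<in> t) \<and>
         (\<forall>v\<in>t. \<exists>n. {i. v @ [i] \<in> t} = {..<n})}"

definition tree_space :: "vertex set measure" where
  "tree_space = sigma rooted_trees (range (\<lambda>v. {t \<in> rooted_trees. v \<in> t}))"

text \<open>
  The tree in which each vertex \<open>v\<close> has \<open>\<omega> v\<close> children. A word \<open>u\<close> is a vertex iff each of its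
  letters is smaller than the number of children of the prefix preceding it.
\<close>

definition tree_of_offspring :: "(vertex \<Rightarrow> nat) \<Rightarrow> vertex set" where
  "tree_of_offspring \<omega> = {u. \<forall>i<length u. u ! i < \<omega> (take i u)}"

definition GW :: "nat pmf \<Rightarrow> vertex set measure" where
  "GW chi = distr (\<Pi>\<^sub>M v\<in>UNIV. measure_pmf chi) tree_space tree_of_offspring"

section \<open>Interpretations\<close>

definition root_child_subtree :: "vertex set \<Rightarrow> nat \<Rightarrow> vertex set" where
  "root_child_subtree t i = {w. i # w \<in> t}"

definition root_child_count :: "vertex set \<Rightarrow> vertex set set \<Rightarrow> nat" where
  "root_child_count t \<T> = card {i. [i] \<in> t \<and> root_child_subtree t i \<in> \<T>}"

text \<open>
  ``\<open>GW chi\<close>-measurable'' means measurable with respect to the completion of \<open>GW chi\<close>, in line with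
  interpretations being considered up to negligible sets.
\<close>

definition interpretation_of :: "nat pmf \<Rightarrow> (nat \<Rightarrow> nat) \<Rightarrow> vertex set set \<Rightarrow> bool" where
  "interpretation_of chi h \<T> \<longleftrightarrow>
     \<T> \<in> sets (completion (GW chi)) \<and>
     (AE t in GW chi. t \<in> \<T> \<longleftrightarrow> h (n_children t []) \<le> root_child_count t \<T>)"

definition associated_interpretation ::
    "nat pmf \<Rightarrow> (nat \<Rightarrow> nat) \<Rightarrow> real \<Rightarrow> vertex set set \<Rightarrow> bool" where
  "associated_interpretation chi h x \<T> \<longleftrightarrow>
     interpretation_of chi h \<T> \<and> measure (completion (GW chi)) \<T> = x"

definition interpretable :: "nat pmf \<Rightarrow> (nat \<Rightarrow> nat) \<Rightarrow> real \<Rightarrow> bool" where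
  "interpretable chi h x \<longleftrightarrow> (\<exists>\<T>. associated_interpretation chi h x \<T>)"

section \<open>Admissible subtrees\<close>

text \<open>
  A subtree containing the root is a connected set of vertices containing the root, that is, one
  closed under taking parents. It need not itself be an element of \<^const>\<open>rooted_trees\<close>, since
  the children kept at a vertex need not be the first ones.
\<close>

definition admissible_subtree :: "(nat \<Rightarrow> nat) \<Rightarrow> vertex set \<Rightarrow> vertex set \<Rightarrow> bool" where
  "admissible_subtree h t s \<longleftrightarrow>
     s \<subseteq> t \<and> [] \<in> s \<and> (\<forall>v i. v @ [i] \<in> s \<longrightarrow> v \<in> s) \<and>
     (\<forall>v\<in>s. h (n_children t v) \<le> n_children s v)"

definition admissible_event :: "(nat \<Rightarrow> nat) \<Rightarrow> vertex set set" where
  "admissible_event h = {t \<in> rooted_trees. \<exists>s. admissible_subtree h t s}"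

end

theory Submission
  imports Defs "HOL-Library.Sublist"
begin

text \<open>
  Call \<open>automaton_step h B\<close> the set of trees that have at least the required number of root-child
  subtrees in \<open>B\<close>. The admissible event is the largest fixed point of this operator. On the one hand an
  admissible subtree restricts to the subtrees below the children that it keeps. On the other hand, if
  every tree in \<open>B\<close> has enough root-child subtrees in \<open>B\<close>, then keeping the vertices whose own subtree
  and whose ancestors' subtrees all lie in \<open>B\<close> yields an admissible subtree
  (\<open>in_admissible_event_if_consistent\<close>). Being a fixed point, the admissible event is an
  interpretation. As trees are locally finite, it is also the decreasing limit of the iterates of the
  operator on the set of all trees (\<open>admissible_event_eq_INT\<close>), which shows that it is measurable.

  By the branching property the operator acts on measures through the automaton distribution map
  (\<open>measure_GW_automaton_step\<close>). Hence the measure of the admissible event is a fixed point of that map,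
  so it is at most \<open>x1\<close>. The map is monotone and the iterates start from measure \<open>1\<close>, so all of them
  have measure at least \<open>x1\<close>, and so has their limit (\<open>measure_GW_admissible_event\<close>).

  For an arbitrary interpretation \<open>\<T>\<close>, almost surely the defining equivalence holds at all vertices of
  the tree at once, and the same construction of an admissible subtree shows that \<open>\<T>\<close> is contained in
  the admissible event up to a null set (\<open>interpretation_subset_admissible\<close>). If \<open>\<T>\<close> also has measure
  \<open>x1\<close>, the two sets agree almost everywhere.
\<close>

section \<open>Rooted trees and their subtrees\<close>

definition subtree_at :: "vertex set \<Rightarrow> vertex \<Rightarrow> vertex set" where
  "subtree_at t v = {w. v @ w \<in> t}"

lemma root_in_rooted_tree: "t \<in> rooted_trees \<Longrightarrow> [] \<in> t"
  by (simp add: rooted_trees_def)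

lemma rooted_tree_parent: "t \<in> rooted_trees \<Longrightarrow> v @ [i] \<in> t \<Longrightarrow> v \<in> t"
  by (auto simp: rooted_trees_def)

lemma rooted_tree_prefix: "t \<in> rooted_trees \<Longrightarrow> v @ w \<in> t \<Longrightarrow> v \<in> t"
proof (induction w rule: rev_induct)
  case (snoc i w)
  then show ?case using rooted_tree_parent[of t "v @ w" i] by simp
qed simp

lemma rooted_tree_children:
  assumes "t \<in> rooted_trees" "v \<in> t"
  shows "{i. v @ [i] \<in> t} = {..<n_children t v}"
proof -
  obtain n where "{i. v @ [i] \<in> t} = {..<n}"
    using assms by (auto simp: rooted_trees_def)
  then show ?thesis by (simp add: n_children_def)
qed

lemma root_child_subtree_eq: "root_child_subtree t i = subtree_at t [i]"
  by (simp add: root_child_subtree_def subtree_at_def)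

lemma subtree_at_Nil [simp]: "subtree_at t [] = t"
  by (simp add: subtree_at_def)

lemma subtree_at_subtree_at: "subtree_at (subtree_at t v) w = subtree_at t (v @ w)"
  by (simp add: subtree_at_def)

lemma n_children_subtree_at: "n_children (subtree_at t v) w = n_children t (v @ w)"
  by (simp add: n_children_def subtree_at_def)

lemma subtree_at_rooted:
  assumes "t \<in> rooted_trees" "v \<in> t"
  shows "subtree_at t v \<in> rooted_trees"
  unfolding rooted_trees_def
proof (intro CollectI conjI allI impI ballI)
  show "[] \<in> subtree_at t v" using assms by (simp add: subtree_at_def)
next
  fix w i assume "w @ [i] \<in> subtree_at t v"
  then show "w \<in> subtree_at t v"
    using rooted_tree_parent[OF assms(1), of "v @ w" i] by (simp add: subtree_at_def)
next
  fix w assume "w \<in> subtree_at t v"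
  then show "\<exists>n. {i. w @ [i] \<in> subtree_at t v} = {..<n}"
    using rooted_tree_children[OF assms(1), of "v @ w"] by (auto simp: subtree_at_def)
qed

lemma finite_children:
  assumes "t \<in> rooted_trees"
  shows "finite {i. v @ [i] \<in> t}"
proof (cases "v \<in> t")
  case True
  then show ?thesis by (simp add: rooted_tree_children assms)
next
  case False
  then have "{i. v @ [i] \<in> t} = {}" using rooted_tree_parent[OF assms] by blast
  then show ?thesis by simp
qed

lemma finite_root_children: "t \<in> rooted_trees \<Longrightarrow> finite {i. [i] \<in> t \<and> P i}"
  using finite_children[of t "[]"] by simp

section \<open>The one-step operator and its largest fixed point\<close>

text \<open>
  For a set \<open>B\<close> of rooted trees, the equation \<open>automaton_step h B = B\<close> is the defining equivalence of
  an interpretation, required of every tree rather than of almost every tree.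
\<close>

definition automaton_step :: "(nat \<Rightarrow> nat) \<Rightarrow> vertex set set \<Rightarrow> vertex set set" where
  "automaton_step h B = {t \<in> rooted_trees. h (n_children t []) \<le> root_child_count t B}"

lemma automaton_step_mono: "B \<subseteq> C \<Longrightarrow> automaton_step h B \<subseteq> automaton_step h C"
  unfolding automaton_step_def root_child_count_def
  by (auto elim!: order_trans intro!: card_mono finite_root_children)

text \<open>
  A root has finitely many children, so the decreasing sets of good children stabilise after
  finitely many steps, and the threshold met at every level is met by the limit.
\<close>

lemma automaton_step_cocontinuous:
  assumes "decseq B"
  shows "(\<Inter>n. automaton_step h (B n)) \<subseteq> automaton_step h (\<Inter>n. B n)"
proof
  fix t assume t: "t \<in> (\<Inter>n. automaton_step h (B n))"
  then have rt: "t \<in> rooted_trees" by (auto simp: automaton_step_def)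
  define S where "S n = {i. [i] \<in> t \<and> root_child_subtree t i \<in> B n}" for n
  have fin: "finite (S n)" for n
    unfolding S_def by (rule finite_root_children[OF rt])
  have S_anti: "S n \<subseteq> S m" if "m \<le> n" for m n
    using that assms by (auto simp: S_def decseq_def)
  obtain N where N: "\<And>n. card (S N) \<le> card (S n)"
    using ex_has_least_nat[of "\<lambda>_. True" 0 "\<lambda>n. card (S n)"] by auto
  have "S N \<subseteq> S n" for n
  proof (cases "n \<le> N")
    case True
    then show ?thesis by (rule S_anti)
  next
    case False
    then have "S n = S N" by (intro card_seteq fin S_anti N) auto
    then show ?thesis by simp
  qed
  then have "S N \<subseteq> {i. [i] \<in> t \<and> root_child_subtree t i \<in> (\<Inter>n. B n)}"
    by (auto simp: S_def)
  then have "card (S N) \<le> root_child_count t (\<Inter>n. B n)"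
    unfolding root_child_count_def by (intro card_mono finite_root_children rt)
  moreover have "h (n_children t []) \<le> card (S N)"
    using t by (auto simp: automaton_step_def root_child_count_def S_def)
  ultimately show "t \<in> automaton_step h (\<Inter>n. B n)"
    using rt by (simp add: automaton_step_def)
qed

text \<open>
  The admissible subtree consists of the vertices of \<open>t\<close> for which the subtrees at the vertex itself
  and at all its ancestors lie in \<open>B\<close>. At such a vertex \<open>v\<close>, the children that are kept are exactly
  those counted by \<open>root_child_count (subtree_at t v) B\<close>. The hypothesis concerns a single tree and
  only its own subtrees, so that it can later be checked for almost every tree.
\<close>

lemma in_admissible_event_if_consistent:
  assumes t: "t \<in> rooted_trees" "t \<in> B"
    and cons: "\<And>v. v \<in> t \<Longrightarrow> subtree_at t v \<in> B \<Longrightarrow>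
           h (n_children t v) \<le> root_child_count (subtree_at t v) B"
  shows "t \<in> admissible_event h"
proof -
  define s where "s = {v \<in> t. \<forall>u. prefix u v \<longrightarrow> subtree_at t u \<in> B}"
  have s_snoc: "v @ [i] \<in> s \<longleftrightarrow> v \<in> s \<and> v @ [i] \<in> t \<and> subtree_at t (v @ [i]) \<in> B" for v i
    unfolding s_def using rooted_tree_parent[OF t(1)] by auto
  have "h (n_children t v) \<le> n_children s v" if "v \<in> s" for v
  proof -
    from that have v: "v \<in> t" "subtree_at t v \<in> B" by (auto simp: s_def)
    have "n_children s v = root_child_count (subtree_at t v) B"
      using that by (simp add: n_children_def root_child_count_def s_snoc root_child_subtree_eq
          subtree_at_subtree_at) (simp add: subtree_at_def)
    then show ?thesis using cons[OF v] by simp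
  qed
  then have "admissible_subtree h t s"
    using t root_in_rooted_tree[OF t(1)] s_snoc by (auto simp: admissible_subtree_def s_def)
  then show ?thesis using t by (auto simp: admissible_event_def)
qed

lemma admissible_event_coinduct:
  assumes "B \<subseteq> automaton_step h B"
  shows "B \<subseteq> admissible_event h"
proof
  fix t assume "t \<in> B"
  moreover have "h (n_children t v) \<le> root_child_count (subtree_at t v) B"
    if "subtree_at t v \<in> B" for v
    using subsetD[OF assms that] by (simp add: automaton_step_def n_children_subtree_at)
  ultimately show "t \<in> admissible_event h"
    using assms by (intro in_admissible_event_if_consistent[of t B]) (auto simp: automaton_step_def)
qed

text \<open>
  An admissible subtree restricts to an admissible subtree below each child of the root that it keeps.
\<close>

lemma admissible_event_subset_step: "admissible_event h \<subseteq> automaton_step h (admissible_event h)"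
proof
  fix t assume "t \<in> admissible_event h"
  then obtain s where t: "t \<in> rooted_trees" and s: "admissible_subtree h t s"
    by (auto simp: admissible_event_def)
  have sub: "[i] \<in> t \<and> root_child_subtree t i \<in> admissible_event h" if "[i] \<in> s" for i
  proof -
    have "[i] \<in> t" using s that by (auto simp: admissible_subtree_def)
    moreover have "admissible_subtree h (subtree_at t [i]) (subtree_at s [i])"
      using s that unfolding admissible_subtree_def n_children_subtree_at
      by (auto simp: subtree_at_def)
    ultimately show ?thesis
      using subtree_at_rooted[OF t, of "[i]"]
      by (auto simp: admissible_event_def root_child_subtree_eq)
  qed
  have "h (n_children t []) \<le> n_children s []"
    using s by (auto simp: admissible_subtree_def)
  also have "\<dots> \<le> root_child_count t (admissible_event h)"
    unfolding n_children_def root_child_count_def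
    using sub by (intro card_mono finite_root_children t) auto
  finally show "t \<in> automaton_step h (admissible_event h)"
    using t by (simp add: automaton_step_def)
qed

text \<open>
  Knaster--Tarski: the admissible event lies below its image and contains every set that does, hence
  it contains its image as well.
\<close>

lemma admissible_event_fixed: "automaton_step h (admissible_event h) = admissible_event h"
  by (intro equalityI admissible_event_subset_step admissible_event_coinduct automaton_step_mono)

lemma automaton_step_iterates_decseq: "decseq (\<lambda>n. (automaton_step h ^^ n) rooted_trees)"
proof (rule decseq_SucI)
  show "(automaton_step h ^^ Suc n) rooted_trees \<subseteq> (automaton_step h ^^ n) rooted_trees" for n
    by (induction n) (auto simp: automaton_step_def[of h rooted_trees]
        dest: automaton_step_mono[THEN subsetD, rotated])
qed

text \<open>
  The \<open>n\<close>-th iterate consists of the trees in which the thresholds can be met on the first \<open>n\<close>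
  levels. These sets are measurable and their measures are computable, which the definition of the
  admissible event through arbitrary subtrees does not give directly.
\<close>

lemma admissible_event_eq_INT: "admissible_event h = (\<Inter>n. (automaton_step h ^^ n) rooted_trees)"
  (is "_ = ?I")
proof (intro equalityI)
  have "admissible_event h \<subseteq> (automaton_step h ^^ n) rooted_trees" for n
  proof (induction n)
    case (Suc n)
    then show ?case using automaton_step_mono[OF Suc, of h] by (simp add: admissible_event_fixed)
  qed (auto simp: admissible_event_def)
  then show "admissible_event h \<subseteq> ?I" by blast
  have "?I \<subseteq> (\<Inter>n. (automaton_step h ^^ Suc n) rooted_trees)" by blast
  also have "\<dots> \<subseteq> automaton_step h ?I"
    using automaton_step_cocontinuous[OF automaton_step_iterates_decseq, of h h] by simp
  finally show "?I \<subseteq> admissible_event h" by (rule admissible_event_coinduct)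
qed

section \<open>Binomial tails and the automaton distribution map\<close>

text \<open>
  Conditioning on the first of \<open>Suc l\<close> trials. This recursion drives both the monotonicity of the
  tail in the success probability and the identification of the law of the number of good children.
\<close>

lemma binomial_tail_Suc:
  assumes "p \<in> {0..1}"
  shows "measure_pmf.prob (binomial_pmf (Suc l) p) {k. Suc m \<le> k} =
     p * measure_pmf.prob (binomial_pmf l p) {k. m \<le> k} +
     (1 - p) * measure_pmf.prob (binomial_pmf l p) {k. Suc m \<le> k}"
proof -
  have *: "(binomial_pmf l p \<bind> (\<lambda>k. return_pmf (c + k))) = map_pmf ((+) c) (binomial_pmf l p)" for c :: nat
    by (simp add: map_pmf_def)
  have "emeasure (measure_pmf (binomial_pmf (Suc l) p)) {k. Suc m \<le> k} =
     ennreal p * emeasure (measure_pmf (binomial_pmf l p)) {k. m \<le> k} +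
     ennreal (1 - p) * emeasure (measure_pmf (binomial_pmf l p)) {k. Suc m \<le> k}"
    unfolding binomial_pmf_Suc[OF assms] *
    using assms by (simp add: emeasure_bind_pmf nn_integral_bernoulli_pmf vimage_def mult.commute)
  then show ?thesis using assms
    by (simp add: measure_pmf.emeasure_eq_measure flip: ennreal_mult ennreal_plus)
qed

lemma binomial_tail_antimono:
  "measure_pmf.prob (binomial_pmf l p) {k. Suc m \<le> k} \<le> measure_pmf.prob (binomial_pmf l p) {k. m \<le> k}"
  by (intro measure_pmf.finite_measure_mono) auto

text \<open>
  In the recursion the larger tail has weight \<open>p\<close> and the smaller one weight \<open>1 - p\<close>, so raising \<open>p\<close>
  moves weight to the larger one.
\<close>

lemma binomial_tail_mono:
  assumes "p \<in> {0..1}" "q \<in> {0..1}" "p \<le> q"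
  shows "measure_pmf.prob (binomial_pmf l p) {k. m \<le> k} \<le> measure_pmf.prob (binomial_pmf l q) {k. m \<le> k}"
proof (induction l arbitrary: m)
  case 0
  then show ?case by (simp add: binomial_pmf_0[OF assms(1)] binomial_pmf_0[OF assms(2)])
next
  case (Suc l)
  show ?case
  proof (cases m)
    case (Suc m')
    let ?f = "\<lambda>p k. measure_pmf.prob (binomial_pmf l p) {j. k \<le> j}"
    have "p * ?f p m' + (1 - p) * ?f p (Suc m') \<le> p * ?f q m' + (1 - p) * ?f q (Suc m')"
      using assms by (intro add_mono mult_left_mono Suc.IH) auto
    also have "\<dots> = ?f q (Suc m') + p * (?f q m' - ?f q (Suc m'))"
      by (simp add: algebra_simps)
    also have "\<dots> \<le> ?f q (Suc m') + q * (?f q m' - ?f q (Suc m'))"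
      using assms binomial_tail_antimono[of l q m'] by (intro add_mono mult_right_mono) auto
    finally show ?thesis using assms
      by (simp only: Suc binomial_tail_Suc) (simp add: algebra_simps)
  qed simp
qed

lemma automaton_map_summable:
  "summable (\<lambda>l. pmf chi l * measure_pmf.prob (binomial_pmf l x) {k. h l \<le> k})"
proof (rule summable_comparison_test')
  have "integrable (count_space UNIV) (pmf chi)" by (rule integrable_pmf)
  then show "summable (pmf chi)"
    by (simp add: integrable_count_space_nat_iff)
  show "norm (pmf chi l * measure_pmf.prob (binomial_pmf l x) {k. h l \<le> k}) \<le> pmf chi l"
    for l by (simp add: mult_left_le)
qed

lemma automaton_map_mono:
  assumes "x \<in> {0..1}" "y \<in> {0..1}" "x \<le> y"
  shows "automaton_map chi h x \<le> automaton_map chi h y"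
  unfolding automaton_map_def
  by (intro suminf_le automaton_map_summable mult_left_mono binomial_tail_mono assms) auto

text \<open>
  Given \<open>F\<close>, the events are independent with probability \<open>p\<close> each, so the number of those that occur
  is binomial. Independence is stated without complements. This is enough because the induction splits
  according to the last event \<open>E l\<close> and obtains the part outside \<open>E l\<close> by subtracting the part inside,
  to which the induction hypothesis applies with \<open>F \<inter> E l\<close> in place of \<open>F\<close>.
\<close>

lemma (in prob_space) prob_at_least_indep_events:
  assumes F: "F \<in> events" and E: "\<And>i. i < l \<Longrightarrow> E i \<in> events" and p: "p \<in> {0..1}"
    and ind: "\<And>S. S \<subseteq> {..<l} \<Longrightarrow> prob (F \<inter> (\<Inter>i\<in>S. E i)) = prob F * p ^ card S"
  shows "prob {\<omega> \<in> F. m \<le> card {i. i < l \<and> \<omega> \<in> E i}}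
    = prob F * measure_pmf.prob (binomial_pmf l p) {k. m \<le> k}"
  using F E ind
proof (induction l arbitrary: m F)
  case 0
  then show ?case by (cases m) (simp_all add: binomial_pmf_0[OF p])
next
  case (Suc l)
  show ?case
  proof (cases m)
    case 0
    then show ?thesis by simp
  next
    case (Suc m')
    let ?N = "\<lambda>\<omega>. card {i. i < l \<and> \<omega> \<in> E i}"
    let ?b = "\<lambda>k. measure_pmf.prob (binomial_pmf l p) {j. k \<le> j}"
    let ?G = "\<lambda>F k. {\<omega> \<in> F. k \<le> ?N \<omega>}"
    have E': "\<And>i. i < l \<Longrightarrow> E i \<in> events" "E l \<in> events" using Suc.prems(2) by auto
    have FE: "F \<inter> E l \<in> events" "F \<in> events" using Suc.prems(1) E' by auto
    have meas: "?G A k \<in> events" if "A \<in> events" for A k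
    proof -
      have E_slice: "{x \<in> space M. i \<in> {i. i < l \<and> x \<in> E i}} \<in> events" for i
      proof (cases "i < l")
        case True
        then have "{x \<in> space M. i \<in> {i. i < l \<and> x \<in> E i}} = E i"
          using sets.sets_into_space[OF E'(1)] by auto
        with True E' show ?thesis by simp
      qed simp
      have "{\<omega> \<in> space M. k \<le> ?N \<omega>} = ?N -` {k..} \<inter> space M" by auto
      also have "\<dots> \<in> events"
        by (rule measurable_sets[OF measurable_card[OF E_slice]]) simp
      finally have "{\<omega> \<in> space M. k \<le> ?N \<omega>} \<in> events" .
      then have "A \<inter> {\<omega> \<in> space M. k \<le> ?N \<omega>} \<in> events" by (rule sets.Int[OF that])
      also have "A \<inter> {\<omega> \<in> space M. k \<le> ?N \<omega>} = ?G A k"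
        using sets.sets_into_space[OF that] by auto
      finally show ?thesis .
    qed
    have pF: "prob (F \<inter> E l) = prob F * p"
      using Suc.prems(3)[of "{l}"] by simp
    have IH1: "prob (?G F k) = prob F * ?b k" for k
    proof (intro Suc.IH FE E' Suc.prems(3))
      show "S \<subseteq> {..<Suc l}" if "S \<subseteq> {..<l}" for S
        using that by (rule order_trans) simp
    qed
    have IH2: "prob (?G (F \<inter> E l) k) = prob F * p * ?b k" for k
    proof -
      have "prob (F \<inter> E l \<inter> (\<Inter>i\<in>S. E i)) = prob (F \<inter> E l) * p ^ card S" if "S \<subseteq> {..<l}" for S
      proof -
        from that have "l \<notin> S" "finite S" by (auto intro: finite_subset)
        then show ?thesis
          using Suc.prems(3)[of "insert l S"] that by (simp add: pF Int_assoc subset_iff less_Suc_eq)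
      qed
      then have "prob (?G (F \<inter> E l) k) = prob (F \<inter> E l) * ?b k"
        by (intro Suc.IH FE E')
      then show ?thesis by (simp add: pF)
    qed
    have N_Suc: "card {i. i < Suc l \<and> \<omega> \<in> E i} = (if \<omega> \<in> E l then Suc (?N \<omega>) else ?N \<omega>)" for \<omega>
    proof -
      have "{i. i < Suc l \<and> \<omega> \<in> E i} =
          (if \<omega> \<in> E l then insert l {i. i < l \<and> \<omega> \<in> E i} else {i. i < l \<and> \<omega> \<in> E i})"
        by (auto simp: less_Suc_eq)
      then show ?thesis by simp
    qed
    have split: "{\<omega> \<in> F. m \<le> card {i. i < Suc l \<and> \<omega> \<in> E i}} =
        ?G (F \<inter> E l) m' \<union> (?G F (Suc m') - ?G (F \<inter> E l) (Suc m'))"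
      unfolding N_Suc Suc by auto
    have sub: "?G (F \<inter> E l) (Suc m') \<subseteq> ?G F (Suc m')" by blast
    have "prob {\<omega> \<in> F. m \<le> card {i. i < Suc l \<and> \<omega> \<in> E i}} =
        prob (?G (F \<inter> E l) m') + prob (?G F (Suc m') - ?G (F \<inter> E l) (Suc m'))"
      unfolding split by (intro finite_measure_Union sets.Diff meas FE) auto
    also have "\<dots> = prob F * p * ?b m' + (prob F * ?b (Suc m') - prob F * p * ?b (Suc m'))"
      by (simp only: finite_measure_Diff[OF meas[OF FE(2)] meas[OF FE(1)] sub] IH1 IH2)
    also have "\<dots> = prob F * (p * ?b m' + (1 - p) * ?b (Suc m'))"
      by (simp add: algebra_simps)
    finally show ?thesis
      by (simp only: Suc binomial_tail_Suc[OF p])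
  qed
qed

section \<open>Measurability on the space of trees\<close>

lemma space_tree_space [simp]: "space tree_space = rooted_trees"
  unfolding tree_space_def by (rule space_measure_of) auto

lemma sets_tree_space_vertex: "{t \<in> rooted_trees. v \<in> t} \<in> sets tree_space"
  unfolding tree_space_def by (auto intro: in_measure_of)

lemma measurable_tree_spaceI:
  assumes "\<And>x. x \<in> space M \<Longrightarrow> f x \<in> rooted_trees"
    and "\<And>v. {x \<in> space M. v \<in> f x} \<in> sets M"
  shows "f \<in> measurable M tree_space"
  unfolding tree_space_def
proof (rule measurable_measure_of)
  fix A assume "A \<in> range (\<lambda>v. {t \<in> rooted_trees. v \<in> t})"
  then obtain v where A: "A = {t \<in> rooted_trees. v \<in> t}" by auto
  have "f -` A \<inter> space M = {x \<in> space M. v \<in> f x}" using assms(1) by (auto simp: A)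
  with assms(2) show "f -` A \<inter> space M \<in> sets M" by simp
qed (use assms in auto)

lemma singleton_root_rooted: "{[]} \<in> rooted_trees"
  by (auto simp: rooted_trees_def intro: exI[of _ 0])

lemma sets_subtree_at_in:
  assumes "B \<in> sets tree_space"
  shows "{t \<in> rooted_trees. v \<in> t \<and> subtree_at t v \<in> B} \<in> sets tree_space"
proof -
  \<comment> \<open>If \<open>v\<close> is not a vertex, \<open>subtree_at t v\<close> is empty and hence not a rooted tree; the one-vertex
     tree is substituted so that the map takes values in the tree space.\<close>
  let ?f = "\<lambda>t. if v \<in> t then subtree_at t v else {[]}"
  have [measurable]: "?f \<in> measurable tree_space tree_space"
  proof (rule measurable_tree_spaceI)
    show "?f t \<in> rooted_trees" if "t \<in> space tree_space" for t
      using that by (simp add: subtree_at_rooted singleton_root_rooted)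
    fix w
    have split: "{t \<in> rooted_trees. v @ w \<in> t} \<union> {t \<in> rooted_trees. v \<notin> t \<and> w = []} =
       {t \<in> space tree_space. w \<in> ?f t}"
      using rooted_tree_prefix by (auto simp: subtree_at_def)
    have outside: "{t \<in> rooted_trees. v \<notin> t \<and> w = []} \<in> sets tree_space"
    proof -
      have "{t \<in> rooted_trees. v \<notin> t} = space tree_space - {t \<in> rooted_trees. v \<in> t}" by auto
      then have "{t \<in> rooted_trees. v \<notin> t} \<in> sets tree_space"
        using sets_tree_space_vertex by (metis sets.compl_sets)
      then show ?thesis by (cases "w = []") simp_all
    qed
    show "{t \<in> space tree_space. w \<in> ?f t} \<in> sets tree_space"
      unfolding split[symmetric] by (intro sets.Un sets_tree_space_vertex outside)
  qed
  have "{t \<in> rooted_trees. v \<in> t} \<inter> (?f -` B \<inter> space tree_space) \<in> sets tree_space"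
    using assms sets_tree_space_vertex by (intro sets.Int measurable_sets) auto
  also have "{t \<in> rooted_trees. v \<in> t} \<inter> (?f -` B \<inter> space tree_space) =
      {t \<in> rooted_trees. v \<in> t \<and> subtree_at t v \<in> B}" by auto
  finally show ?thesis .
qed

lemma automaton_step_sets:
  assumes "B \<in> sets tree_space"
  shows "automaton_step h B \<in> sets tree_space"
proof -
  have children: "{t \<in> space tree_space. i \<in> {i. [] @ [i] \<in> t}} \<in> sets tree_space" for i
    using sets_tree_space_vertex[of "[] @ [i]"] by (simp only: mem_Collect_eq space_tree_space)
  have good_children: "{t \<in> space tree_space. i \<in> {i. [i] \<in> t \<and> root_child_subtree t i \<in> B}}
      \<in> sets tree_space" for i
    using sets_subtree_at_in[OF assms, of "[i]"]
    by (simp only: mem_Collect_eq space_tree_space root_child_subtree_eq)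
  have n: "(\<lambda>t. n_children t []) \<in> measurable tree_space (count_space UNIV)"
    unfolding n_children_def by (rule measurable_card[OF children])
  have c: "(\<lambda>t. root_child_count t B) \<in> measurable tree_space (count_space UNIV)"
    unfolding root_child_count_def by (rule measurable_card[OF good_children])
  have "automaton_step h B = (\<Union>l. ((\<lambda>t. n_children t []) -` {l} \<inter> space tree_space) \<inter>
      ((\<lambda>t. root_child_count t B) -` {h l..} \<inter> space tree_space))"
    by (auto simp: automaton_step_def)
  also have "\<dots> \<in> sets tree_space"
    by (intro sets.countable_UN'' sets.Int measurable_sets[OF n] measurable_sets[OF c]) simp_all
  finally show ?thesis .
qed

lemma automaton_step_iterates_sets: "(automaton_step h ^^ n) rooted_trees \<in> sets tree_space"
proof (induction n)
  case 0
  show ?case using sets.top[of tree_space] by simp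
qed (simp add: automaton_step_sets)

lemma admissible_event_sets: "admissible_event h \<in> sets tree_space"
  unfolding admissible_event_eq_INT using automaton_step_iterates_sets by (intro sets.countable_INT) auto

section \<open>The branching property of offspring families\<close>

abbreviation offspring_measure :: "nat pmf \<Rightarrow> (vertex \<Rightarrow> nat) measure" where
  "offspring_measure chi \<equiv> \<Pi>\<^sub>M v\<in>UNIV. measure_pmf chi"

definition shift_to :: "vertex \<Rightarrow> (vertex \<Rightarrow> 'a) \<Rightarrow> vertex \<Rightarrow> 'a" where
  "shift_to v \<omega> = (\<lambda>w. \<omega> (v @ w))"

lemma Nil_in_tree_of_offspring [simp]: "[] \<in> tree_of_offspring \<omega>"
  by (simp add: tree_of_offspring_def)

lemma snoc_in_tree_of_offspring:
  "v @ [i] \<in> tree_of_offspring \<omega> \<longleftrightarrow> v \<in> tree_of_offspring \<omega> \<and> i < \<omega> v"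
  by (auto simp: tree_of_offspring_def nth_append less_Suc_eq split: if_splits)

lemma tree_of_offspring_rooted: "tree_of_offspring \<omega> \<in> rooted_trees"
  by (auto simp: rooted_trees_def snoc_in_tree_of_offspring)

lemma n_children_tree_of_offspring:
  "v \<in> tree_of_offspring \<omega> \<Longrightarrow> n_children (tree_of_offspring \<omega>) v = \<omega> v"
  by (simp add: n_children_def snoc_in_tree_of_offspring lessThan_def[symmetric])

lemma subtree_at_tree_of_offspring:
  assumes "v \<in> tree_of_offspring \<omega>"
  shows "subtree_at (tree_of_offspring \<omega>) v = tree_of_offspring (shift_to v \<omega>)"
proof -
  have "v @ w \<in> tree_of_offspring \<omega> \<longleftrightarrow> w \<in> tree_of_offspring (shift_to v \<omega>)" for w
  proof (induction w rule: rev_induct)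
    case (snoc i w)
    then show ?case
      using snoc_in_tree_of_offspring[of "v @ w" i \<omega>] snoc_in_tree_of_offspring[of w i "shift_to v \<omega>"]
      by (simp add: shift_to_def)
  qed (simp add: assms)
  then show ?thesis by (auto simp: subtree_at_def)
qed

lemma space_offspring_measure [simp]: "space (offspring_measure chi) = UNIV"
  by (simp add: space_PiM)

lemma prob_space_offspring_measure: "prob_space (offspring_measure chi)"
  by (intro prob_space_PiM measure_pmf.prob_space_axioms)

lemma tree_of_offspring_measurable [measurable]:
  "tree_of_offspring \<in> measurable (offspring_measure chi) tree_space"
proof (rule measurable_tree_spaceI)
  fix v
  have "{\<omega> \<in> space (offspring_measure chi). \<forall>i\<in>{..<length v}. v ! i < \<omega> (take i v)}
      \<in> sets (offspring_measure chi)"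
    by measurable
  then show "{\<omega> \<in> space (offspring_measure chi). v \<in> tree_of_offspring \<omega>}
      \<in> sets (offspring_measure chi)"
    by (simp add: tree_of_offspring_def lessThan_def Ball_def)
qed (rule tree_of_offspring_rooted)

lemma distr_shift:
  "distr (offspring_measure chi) (offspring_measure chi) (shift_to v) = offspring_measure chi"
proof -
  have "shift_to v = (\<lambda>\<omega> :: vertex \<Rightarrow> nat. \<lambda>w\<in>UNIV. \<omega> (v @ w))"
    by (simp add: shift_to_def fun_eq_iff)
  then show ?thesis
    using distr_PiM_reindex[of UNIV "\<lambda>_. measure_pmf chi" "(@) v" UNIV]
    by (simp add: measure_pmf.prob_space_axioms inj_on_def)
qed

lemma shift_measurable [measurable]:
  "shift_to v \<in> measurable (offspring_measure chi) (offspring_measure chi)"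
  unfolding shift_to_def[abs_def]
proof (rule measurable_PiM_single')
  show "(\<lambda>\<omega>. \<omega> (v @ w)) \<in> measurable (offspring_measure chi) (measure_pmf chi)" for w
    by (rule measurable_component_singleton) simp
qed (simp add: space_PiM)

text \<open>
  The branching property: the offspring number of the root and the offspring families below the
  children of the root depend on disjoint blocks of coordinates, and each family below a child has
  the same law as the whole family. Offspring numbers are assigned to
  all words, so the family below \<open>[i]\<close> makes sense even when the root has at most \<open>i\<close> children.
\<close>

lemma indep_root_and_shifts:
  assumes B: "B \<in> sets (offspring_measure chi)" and "finite S"
  shows "measure (offspring_measure chi) ({\<omega>. \<omega> [] = l} \<inter> (\<Inter>i\<in>S. shift_to [i] -` B)) =
     pmf chi l * measure (offspring_measure chi) B ^ card S"
proof -
  interpret prob_space "offspring_measure chi" by (rule prob_space_offspring_measure)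
  let ?P = "offspring_measure chi"
  \<comment> \<open>The block of the root is indexed by \<open>None\<close>, the block below its \<open>i\<close>-th child by \<open>Some i\<close>.\<close>
  define K :: "nat option \<Rightarrow> vertex set" where
    "K j = (case j of None \<Rightarrow> {[]} | Some i \<Rightarrow> range (Cons i))" for j
  define A :: "nat option \<Rightarrow> (vertex \<Rightarrow> nat) set" where
    "A j = (case j of None \<Rightarrow> {\<omega> \<in> space (\<Pi>\<^sub>M v\<in>K j. measure_pmf chi). \<omega> [] = l}
       | Some i \<Rightarrow> {\<omega> \<in> space (\<Pi>\<^sub>M v\<in>K j. measure_pmf chi). shift_to [i] \<omega> \<in> B})" for j
  have component: "distr ?P (measure_pmf chi) (\<lambda>\<omega>. \<omega> v) = measure_pmf chi" for v
    by (rule distr_PiM_component[of UNIV "\<lambda>_. measure_pmf chi" v])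
      (simp_all add: measure_pmf.prob_space_axioms)
  have coord: "indep_vars (\<lambda>_. measure_pmf chi) (\<lambda>v \<omega>. \<omega> v) (UNIV :: vertex set)"
    by (subst indep_vars_iff_distr_eq_PiM)
      (simp_all add: component restrict_def)
  have "disjoint_family_on K UNIV"
    by (auto simp: disjoint_family_on_def K_def split: option.splits)
  then have ind: "indep_vars (\<lambda>j. \<Pi>\<^sub>M v\<in>K j. measure_pmf chi) (\<lambda>j \<omega>. restrict \<omega> (K j)) UNIV"
    by (intro indep_vars_restrict[OF coord]) auto
  have A_sets: "A j \<in> sets (\<Pi>\<^sub>M v\<in>K j. measure_pmf chi)" for j
  proof (cases j)
    case None
    have [measurable]: "(\<lambda>\<omega>. \<omega> []) \<in> measurable (\<Pi>\<^sub>M v\<in>K j. measure_pmf chi) (measure_pmf chi)"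
      by (rule measurable_component_singleton) (simp add: None K_def)
    have "{\<omega> \<in> space (\<Pi>\<^sub>M v\<in>K j. measure_pmf chi). \<omega> [] = l} \<in> sets (\<Pi>\<^sub>M v\<in>K j. measure_pmf chi)"
      by measurable
    then show ?thesis by (simp add: A_def None)
  next
    case (Some i)
    have [measurable]: "shift_to [i] \<in> measurable (\<Pi>\<^sub>M v\<in>K j. measure_pmf chi) ?P"
      unfolding shift_to_def[abs_def]
      by (intro measurable_PiM_single' measurable_component_singleton)
        (auto simp: Some K_def)
    have "A j = shift_to [i] -` B \<inter> space (\<Pi>\<^sub>M v\<in>K j. measure_pmf chi)"
      by (auto simp: A_def Some)
    also have "\<dots> \<in> sets (\<Pi>\<^sub>M v\<in>K j. measure_pmf chi)"
      by (rule measurable_sets[OF _ B]) measurable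
    finally show ?thesis .
  qed
  have pre: "(\<lambda>\<omega>. restrict \<omega> (K j)) -` A j \<inter> space ?P =
      (case j of None \<Rightarrow> {\<omega>. \<omega> [] = l} | Some i \<Rightarrow> shift_to [i] -` B)" for j
    by (auto simp: A_def K_def shift_to_def space_PiM split: option.splits)
  have shift: "prob (shift_to [i] -` B) = prob B" for i
    using measure_distr[OF shift_measurable[of "[i]" chi] B] by (simp add: distr_shift)
  have root: "prob {\<omega>. \<omega> [] = l} = pmf chi l"
  proof -
    have "prob {\<omega>. \<omega> [] = l} = measure (distr ?P (measure_pmf chi) (\<lambda>\<omega>. \<omega> [])) {l}"
      by (subst measure_distr) (auto simp: vimage_def)
    then show ?thesis
      by (simp add: component measure_pmf_single)
  qed
  have "measure ?P ({\<omega>. \<omega> [] = l} \<inter> (\<Inter>i\<in>S. shift_to [i] -` B)) =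
      prob (\<Inter>j\<in>insert None (Some ` S). (\<lambda>\<omega>. restrict \<omega> (K j)) -` A j \<inter> space ?P)"
    unfolding pre by simp
  also have "\<dots> = (\<Prod>j\<in>insert None (Some ` S). prob ((\<lambda>\<omega>. restrict \<omega> (K j)) -` A j \<inter> space ?P))"
    by (rule indep_varsD[OF ind]) (use A_sets \<open>finite S\<close> in auto)
  also have "\<dots> = prob {\<omega>. \<omega> [] = l} * (\<Prod>i\<in>S. prob (shift_to [i] -` B))"
    unfolding pre using \<open>finite S\<close> by (simp add: prod.reindex)
  finally show ?thesis by (simp add: root shift)
qed

section \<open>The measure of the admissible event\<close>

lemma measure_GW:
  "B \<in> sets tree_space \<Longrightarrow> measure (GW chi) B = measure (offspring_measure chi) (tree_of_offspring -` B)"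
  unfolding GW_def by (simp add: measure_distr)

lemma prob_space_GW: "prob_space (GW chi)"
  unfolding GW_def
  by (rule prob_space.prob_space_distr[OF prob_space_offspring_measure]) simp

lemma sets_GW [simp]: "sets (GW chi) = sets tree_space"
  by (simp add: GW_def)

lemma space_GW [simp]: "space (GW chi) = rooted_trees"
  by (simp add: GW_def)

lemma tree_of_offspring_in_step:
  "tree_of_offspring \<omega> \<in> automaton_step h B \<longleftrightarrow>
     h (\<omega> []) \<le> card {i. i < \<omega> [] \<and> tree_of_offspring (shift_to [i] \<omega>) \<in> B}"
proof -
  have child: "[i] \<in> tree_of_offspring \<omega> \<longleftrightarrow> i < \<omega> []" for i
    using snoc_in_tree_of_offspring[of "[]" i \<omega>] by simp
  have "{i. [i] \<in> tree_of_offspring \<omega> \<and> root_child_subtree (tree_of_offspring \<omega>) i \<in> B} =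
      {i. i < \<omega> [] \<and> tree_of_offspring (shift_to [i] \<omega>) \<in> B}"
    using subtree_at_tree_of_offspring by (auto simp: root_child_subtree_eq child)
  then show ?thesis
    by (simp add: automaton_step_def tree_of_offspring_rooted n_children_tree_of_offspring
        root_child_count_def)
qed

text \<open>
  Given \<open>l\<close> children, the number of root-child subtrees in \<open>B\<close> is binomial with parameters \<open>l\<close> and
  the measure of \<open>B\<close>; summing over \<open>l\<close> gives the automaton distribution map.
\<close>

lemma measure_GW_automaton_step:
  assumes B: "B \<in> sets tree_space"
  shows "measure (GW chi) (automaton_step h B) = automaton_map chi h (measure (GW chi) B)"
proof -
  interpret prob_space "offspring_measure chi" by (rule prob_space_offspring_measure)
  let ?P = "offspring_measure chi"
  define C where "C = tree_of_offspring -` B"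
  have C: "C \<in> events"
    using measurable_sets[OF tree_of_offspring_measurable B, of chi] by (simp add: C_def)
  have GWB: "measure (GW chi) B = prob C" by (simp add: measure_GW B C_def)
  \<comment> \<open>The preimage of \<open>automaton_step h B\<close> is split according to the number \<open>l\<close> of children of the root.\<close>
  define D where "D l = {\<omega> \<in> {\<omega>. \<omega> [] = l}. h l \<le> card {i. i < l \<and> \<omega> \<in> shift_to [i] -` C}}" for l
  have root: "{\<omega>. \<omega> [] = l} \<in> events" for l
  proof -
    have "{\<omega> \<in> space ?P. \<omega> [] = l} \<in> events" by measurable
    then show ?thesis by simp
  qed
  have shC: "shift_to [i] -` C \<in> events" for i
    using measurable_sets[OF shift_measurable C, of "[i]"] by simp
  have p0: "prob {\<omega>. \<omega> [] = l} = pmf chi l" for l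
    using indep_root_and_shifts[OF C, of "{}" l] by simp
  have prob_D: "prob (D l) = pmf chi l * measure_pmf.prob (binomial_pmf l (prob C)) {k. h l \<le> k}" for l
    unfolding D_def p0[symmetric]
    by (intro prob_at_least_indep_events root shC)
      (auto simp: indep_root_and_shifts[OF C] p0 finite_subset)
  have step: "automaton_step h B \<in> sets tree_space" by (rule automaton_step_sets[OF B])
  have D_sets: "D l \<in> events" for l
  proof -
    have "D l = {\<omega>. \<omega> [] = l} \<inter> tree_of_offspring -` automaton_step h B"
      by (auto simp: D_def C_def tree_of_offspring_in_step)
    then show ?thesis
      using root measurable_sets[OF tree_of_offspring_measurable step, of chi] by auto
  qed
  have "tree_of_offspring -` automaton_step h B = (\<Union>l. D l)"
    by (auto simp: D_def C_def tree_of_offspring_in_step)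
  then have "measure (GW chi) (automaton_step h B) = prob (\<Union>l. D l)"
    by (simp add: measure_GW step)
  also have "(\<lambda>l. prob (D l)) sums prob (\<Union>l. D l)"
    by (rule finite_measure_UNION) (auto simp: D_sets disjoint_family_on_def, auto simp: D_def)
  then have "prob (\<Union>l. D l) = (\<Sum>l. prob (D l))" by (rule sums_unique)
  also have "\<dots> = automaton_map chi h (measure (GW chi) B)"
    by (simp add: automaton_map_def prob_D GWB)
  finally show ?thesis .
qed

text \<open>
  The measure is a fixed point because the event is a fixed point of the one-step operator, so it is
  at most \<open>x\<close>. Conversely the iterates start with measure \<open>1 \<ge> x\<close>, and monotonicity of the map keeps
  their measures above its fixed point \<open>x\<close>; so does their limit.
\<close>

lemma measure_GW_admissible_event:
  assumes "largest_fixed_point chi h x"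
  shows "measure (GW chi) (admissible_event h) = x"
proof (rule antisym)
  interpret prob_space "GW chi" by (rule prob_space_GW)
  have x: "x \<in> {0..1}" "automaton_map chi h x = x"
    and max: "\<And>y. y \<in> {0..1} \<Longrightarrow> automaton_map chi h y = y \<Longrightarrow> y \<le> x"
    using assms by (auto simp: largest_fixed_point_def)
  have "automaton_map chi h (prob (admissible_event h)) = prob (admissible_event h)"
    using measure_GW_automaton_step[OF admissible_event_sets, of chi h h]
    by (simp add: admissible_event_fixed)
  then show "prob (admissible_event h) \<le> x"
    by (intro max) auto
  let ?A = "\<lambda>n. (automaton_step h ^^ n) rooted_trees"
  have lower: "x \<le> prob (?A n)" for n
  proof (induction n)
    case 0
    then show ?case using x prob_space by simp
  next
    case (Suc n)
    have "x \<le> automaton_map chi h (prob (?A n))"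
      using automaton_map_mono[OF x(1) _ Suc, of chi h] x(2) by simp
    then show ?case by (simp add: measure_GW_automaton_step automaton_step_iterates_sets)
  qed
  have "(\<lambda>n. prob (?A n)) \<longlonglongrightarrow> prob (\<Inter>n. ?A n)"
    using automaton_step_iterates_sets automaton_step_iterates_decseq
    by (intro finite_Lim_measure_decseq) auto
  then show "x \<le> prob (admissible_event h)"
    unfolding admissible_event_eq_INT using lower by (intro LIMSEQ_le_const) auto
qed

section \<open>Interpretations and the admissible event\<close>

text \<open>
  The defining equivalence of an interpretation holds at the root almost surely. Shifts preserve the
  offspring measure and there are countably many words, so almost surely it holds at all vertices
  simultaneously. The admissible subtree can then be read off.
\<close>

lemma interpretation_subset_admissible:
  assumes "interpretation_of chi h \<T>"
  shows "AE t in GW chi. t \<in> \<T> \<longrightarrow> t \<in> admissible_event h"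
proof -
  let ?P = "offspring_measure chi" and ?S = "main_part (GW chi) \<T>"
  let ?Q = "\<lambda>t. t \<in> \<T> \<longleftrightarrow> h (n_children t []) \<le> root_child_count t \<T>"
  have T: "\<T> \<in> sets (completion (GW chi))" and rec: "AE t in GW chi. ?Q t"
    using assms by (auto simp: interpretation_of_def)
  \<comment> \<open>\<open>\<T>\<close> is measurable only for the completion, so the conclusion is brought back from offspring
     families to trees for its measurable main part.\<close>
  have main: "AE t in GW chi. t \<in> \<T> \<longleftrightarrow> t \<in> ?S"
    using AE_notin_null_part[OF T] main_part_null_part_Un[OF T] by (elim AE_mp) auto
  have "AE \<omega> in ?P. ?Q (tree_of_offspring (shift_to v \<omega>))" for v
  proof (rule AE_distrD[OF shift_measurable])
    show "AE \<omega> in distr ?P ?P (shift_to v). ?Q (tree_of_offspring \<omega>)"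
      unfolding distr_shift using rec unfolding GW_def by (rule AE_distrD[OF tree_of_offspring_measurable])
  qed
  then have "AE \<omega> in ?P. \<forall>v. ?Q (tree_of_offspring (shift_to v \<omega>))"
    by (simp add: AE_all_countable)
  then have "AE \<omega> in ?P. tree_of_offspring \<omega> \<in> \<T> \<longrightarrow> tree_of_offspring \<omega> \<in> admissible_event h"
  proof (rule AE_mp, intro AE_I2 impI)
    fix \<omega> assume Q: "\<forall>v. ?Q (tree_of_offspring (shift_to v \<omega>))" and "tree_of_offspring \<omega> \<in> \<T>"
    then show "tree_of_offspring \<omega> \<in> admissible_event h"
      by (intro in_admissible_event_if_consistent[of _ \<T>] tree_of_offspring_rooted)
        (auto simp: subtree_at_tree_of_offspring n_children_tree_of_offspring shift_to_def)
  qed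
  moreover have "AE \<omega> in ?P. tree_of_offspring \<omega> \<in> \<T> \<longleftrightarrow> tree_of_offspring \<omega> \<in> ?S"
    using main unfolding GW_def by (rule AE_distrD[OF tree_of_offspring_measurable])
  ultimately have "AE \<omega> in ?P. tree_of_offspring \<omega> \<in> ?S \<longrightarrow> tree_of_offspring \<omega> \<in> admissible_event h"
    by eventually_elim auto
  moreover have "{t \<in> space tree_space. t \<in> ?S \<longrightarrow> t \<in> admissible_event h} \<in> sets tree_space"
  proof -
    have "{t \<in> space tree_space. t \<in> ?S \<longrightarrow> t \<in> admissible_event h} =
        space tree_space - (?S - admissible_event h)" by auto
    also have "\<dots> \<in> sets tree_space"
      using main_part_sets[OF T] by (intro sets.Diff sets.top admissible_event_sets) simp
    finally show ?thesis .
  qed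
  ultimately have "AE t in GW chi. t \<in> ?S \<longrightarrow> t \<in> admissible_event h"
    unfolding GW_def by (subst AE_distr_iff) (simp_all add: GW_def)
  with main show ?thesis by eventually_elim auto
qed

lemma interpretation_of_admissible_event: "interpretation_of chi h (admissible_event h)"
  unfolding interpretation_of_def
proof
  show "admissible_event h \<in> sets (completion (GW chi))"
    by (simp add: admissible_event_sets sets_completionI_sets)
  show "AE t in GW chi. t \<in> admissible_event h \<longleftrightarrow>
      h (n_children t []) \<le> root_child_count t (admissible_event h)"
  proof (rule AE_I2)
    fix t assume "t \<in> space (GW chi)"
    then show "t \<in> admissible_event h \<longleftrightarrow>
      h (n_children t []) \<le> root_child_count t (admissible_event h)"
      using admissible_event_fixed[of h] by (auto simp: automaton_step_def)
  qed
qed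

lemma (in finite_measure) AE_iff_if_AE_subset_and_measure_eq:
  assumes [measurable]: "A \<in> sets M" "B \<in> sets M"
    and sub: "AE x in M. x \<in> A \<longrightarrow> x \<in> B" and eq: "measure M A = measure M B"
  shows "AE x in M. x \<in> A \<longleftrightarrow> x \<in> B"
proof -
  have "measure M (A \<inter> B) = measure M A"
    using sub by (intro finite_measure_eq_AE) auto
  then have "measure M (B - A) = 0"
    using finite_measure_Diff'[of B A] eq by (simp add: Int_commute)
  then have "AE x in M. x \<notin> B - A"
    by (intro AE_not_in) (simp add: null_sets_def emeasure_eq_measure)
  with sub show ?thesis by eventually_elim auto
qed

theorem proposition1p9:
  fixes chi :: "nat pmf" and h :: "nat \<Rightarrow> nat" and x1 :: real
  assumes "chi \<in> Pi_infinity"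
    and "\<exists>a b. a \<in> set_pmf chi \<and> b \<in> set_pmf chi \<and> a \<noteq> b"
    and "recursive_tree_system chi h"
    and "largest_fixed_point chi h x1"
  shows "interpretable chi h x1 \<and>
         associated_interpretation chi h x1 (admissible_event h) \<and>
         (\<forall>\<T>. associated_interpretation chi h x1 \<T> \<longrightarrow>
           (AE t in GW chi. t \<in> \<T> \<longleftrightarrow> t \<in> admissible_event h))"
proof -
  have meas: "measure (completion (GW chi)) (admissible_event h) = x1"
    by (simp add: measure_GW_admissible_event[OF assms(4)] admissible_event_sets)
  then have adm: "associated_interpretation chi h x1 (admissible_event h)"
    by (simp add: associated_interpretation_def interpretation_of_admissible_event)
  have "AE t in GW chi. t \<in> \<T> \<longleftrightarrow> t \<in> admissible_event h"
    if "associated_interpretation chi h x1 \<T>" for \<T>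
  proof -
    interpret prob_space "completion (GW chi)"
      by (rule prob_space.prob_space_completion[OF prob_space_GW])
    have T: "interpretation_of chi h \<T>" "prob \<T> = x1"
      using that by (auto simp: associated_interpretation_def)
    have "AE t in completion (GW chi). t \<in> \<T> \<longleftrightarrow> t \<in> admissible_event h"
    proof (rule AE_iff_if_AE_subset_and_measure_eq)
      show "\<T> \<in> events" "admissible_event h \<in> events"
        using T(1) interpretation_of_admissible_event by (auto simp: interpretation_of_def)
      show "AE t in completion (GW chi). t \<in> \<T> \<longrightarrow> t \<in> admissible_event h"
        by (rule AE_completion[OF interpretation_subset_admissible[OF T(1)]])
    qed (simp add: T(2) meas)
    then show ?thesis by (simp add: AE_completion_iff)
  qed
  with adm show ?thesis by (auto simp: interpretable_def)
qed

end
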